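(* Let $P$, $k$, $f=P^{k+1}$, $D$, $A_0,\dots,A_D$, $\Xi_k$, $x_n(\mathbf g)$, $\mathbf E_f$, $\Omega_0$, $\rho^f_n$ be as in the context, and consider the matrices with index set $\mathbb Z\times\mathbb Z$ (row index $m$, column index $n$) $$\mathcal A_f=\bigl(-A_{n-m}\,\mathbf 1_{0\le n-m\le D}\bigr)_{m,n\in\mathbb Z},\qquad \mathcal B_f=\bigl(\rho^f_{m-n}\bigr)_{m,n\in\mathbb Z}.$$ Then the following hold. (1) $\mathcal B_f$ is the inverse matrix of $\mathcal A_f$. (2) Let $\mathbf g\in\Xi_k$, let $\epsilon_m=\epsilon(x_m(\mathbf g))$ for $m\in\mathbb Z$, and define $s_m=-A_0\epsilon_m-A_1\epsilon_{m+1}-\cdots-A_D\epsilon_{m+D}$ for $m\in\mathbb Z$. Then $(\epsilon_m)_{m\in\mathbb Z}=\mathcal B_f\,(s_m)_{m\in\mathbb Z}$, i.e. $\epsilon_m=\sum_{n\in\mathbb Z}\rho^f_{m-n}s_n$ for every $m\in\mathbb Z$. (3) Suppose that $P(X)$ is monic. Then for any $(t_m)_{m\in\mathbb Z}\in\Omega_0$ there exists $(\epsilon_m)_{m\in\mathbb Z}\in\mathbf E_f$ such that $\mathcal B_f\,(t_m)_{m\in\mathbb Z}\equiv(\epsilon_m)_{m\in\mathbb Z}\pmod{\mathbb Z}$ (componentwise).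
   Context: Setting. $P(X)=a_dX^d+\cdots+a_0\in\mathbb Z[X]$ with $d\ge1$, $a_d\ge1$, such that (i) $\gcd(a_d,\dots,a_0)=1$ and $a_0\ne0$; (ii) $P$ has no multiple roots; (iii) every irreducible factor of $P$ in $\mathbb Z[X]$ has at least one root of modulus greater than $1$. The roots of $P$ are $\alpha_1,\dots,\alpha_d$, ordered so that $|\alpha_i|>1$ for $1\le i\le p$ and $|\alpha_i|\le1$ for $p+1\le i\le d$, where $p=r_1+2r_2$, $\alpha_i\in\mathbb R$ for $1\le i\le r_1$, and $\alpha_{r_1+i}\in\mathbb C\setminus\mathbb R$, $\alpha_{r_1+r_2+i}=\overline{\alpha_{r_1+i}}$ for $1\le i\le r_2$. Let $k\ge0$ be an integer, $D=(k+1)d$, and $f(X)=P(X)^{k+1}=A_DX^D+\cdots+A_0\in\mathbb Z[X]$. $\Xi_k$ is the set of $\mathbf g=(g_1,\dots,g_p)\in\mathbb R[X]^{r_1}\times\mathbb C[X]^{2r_2}$ with $\deg g_i\le k$ for all $i$ and $\overline{g_{r_1+i}(X)}=g_{r_1+r_2+i}(X)$ for $1\le i\le r_2$ (the bar conjugates the coefficients). For $\mathbf g\in\Xi_k$ and $n\in\mathbb Z$ put $x_n(\mathbf g)=\sum_{i=1}^p g_i(n)\alpha_i^n\in\mathbb R$. For $x\in\mathbb R$ write uniquely $x=u(x)+\epsilon(x)$ with $u(x)\in\mathbb Z$ and $\epsilon(x)\in[-1/2,1/2)$. Put $\mathbf E_f=\{(\epsilon(x_m(\mathbf g)))_{m\in\mathbb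 Z} : \mathbf g\in\Xi_k\}$. $\Omega_0$ is the set of integer sequences $(t_m)_{m\in\mathbb Z}$ such that there is $M<0$ with $t_m=0$ for all $m<M$, and $t_m=O(\lambda^m)$ as $m\to\infty$ for every $\lambda>1$. For $n\in\mathbb Z$, $\rho^f_n=\frac{-1}{2\pi i}\int_{|z|=r}\frac{z^{n-1}}{f(z)}\,dz$, the circle being positively oriented with $1<r<\min_{1\le i\le p}|\alpha_i|$ (so roots of $P$ on the unit circle are enclosed). These are real numbers. $\mathbf 1$ denotes the indicator function. For matrices $\mathcal A=(a_{m,n})$, $\mathcal B=(b_{m,n})$ indexed by $\mathbb Z\times\mathbb Z$, $\mathcal A\mathcal B=(\sum_{j\in\mathbb Z}a_{m,j}b_{j,n})_{m,n}$ is defined when all these sums converge; similarly $\mathcal A(y_m)_{m\in\mathbb Z}=(\sum_{j\in\mathbb Z}a_{m,j}y_j)_{m}$. $\mathcal B$ is called an inverse matrix of $\mathcal A$ if $\mathcal A\mathcal B$ and $\mathcal B\mathcal A$ are both defined and both equal $(\mathbf 1_{m=n})_{m,n\in\mathbb Z}$. *)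

theory Defs
  imports
    "HOL-Complex_Analysis.Complex_Analysis"
    "HOL-Computational_Algebra.Computational_Algebra"
    "HOL-Library.Landau_Symbols"
begin

abbreviation cpoly :: "int poly \<Rightarrow> complex poly" where
  "cpoly \<equiv> map_poly of_int"

(* Since the content of P is 1, no irreducible factor of P in Z[X] is a constant. *)
definition admissible_poly :: "int poly \<Rightarrow> bool" where
  "admissible_poly P \<longleftrightarrow>
     degree P \<ge> 1 \<and> lead_coeff P \<ge> 1 \<and> content P = 1 \<and> coeff P 0 \<noteq> 0 \<and>
     rsquarefree (cpoly P) \<and>
     (\<forall>Q. irreducible Q \<longrightarrow> Q dvd P \<longrightarrow> (\<exists>z. poly (cpoly Q) z = 0 \<and> cmod z > 1))"

(* The roots are numbered from 1; the values of \<alpha> outside {1..degree P} are irrelevant. *)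
definition root_numbering :: "int poly \<Rightarrow> nat \<Rightarrow> nat \<Rightarrow> (nat \<Rightarrow> complex) \<Rightarrow> bool" where
  "root_numbering P r1 r2 \<alpha> \<longleftrightarrow>
     r1 + 2 * r2 \<le> degree P \<and>
     bij_betw \<alpha> {1..degree P} {z. poly (cpoly P) z = 0} \<and>
     (\<forall>i\<in>{1..r1 + 2 * r2}. cmod (\<alpha> i) > 1) \<and>
     (\<forall>i\<in>{r1 + 2 * r2 + 1..degree P}. cmod (\<alpha> i) \<le> 1) \<and>
     (\<forall>i\<in>{1..r1}. \<alpha> i \<in> \<real>) \<and>
     (\<forall>i\<in>{1..r2}. \<alpha> (r1 + i) \<notin> \<real> \<and> \<alpha> (r1 + r2 + i) = cnj (\<alpha> (r1 + i)))"

(* A tuple (g_1, ..., g_p) with p = r1 + 2 * r2 is a function on nat of which only the values on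
   {1..p} matter; real polynomials are complex polynomials with real coefficients. *)
definition Xi :: "nat \<Rightarrow> nat \<Rightarrow> nat \<Rightarrow> (nat \<Rightarrow> complex poly) set" where
  "Xi r1 r2 k = {g.
     (\<forall>i\<in>{1..r1 + 2 * r2}. degree (g i) \<le> k) \<and>
     (\<forall>i\<in>{1..r1}. \<forall>j. coeff (g i) j \<in> \<real>) \<and>
     (\<forall>i\<in>{1..r2}. map_poly cnj (g (r1 + i)) = g (r1 + r2 + i))}"

(* The sum is real for g in Xi, so Re only changes its type: see of_real_x_seq. *)
definition x_seq :: "nat \<Rightarrow> nat \<Rightarrow> (nat \<Rightarrow> complex) \<Rightarrow> (nat \<Rightarrow> complex poly) \<Rightarrow> int \<Rightarrow> real" where
  "x_seq r1 r2 \<alpha> g n = Re (\<Sum>i=1..r1 + 2 * r2. poly (g i) (of_int n) * \<alpha> i powi n)"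

lemma of_real_x_seq:
  assumes "root_numbering P r1 r2 \<alpha>" "g \<in> Xi r1 r2 k"
  shows "complex_of_real (x_seq r1 r2 \<alpha> g n) =
           (\<Sum>i=1..r1 + 2 * r2. poly (g i) (of_int n) * \<alpha> i powi n)"
proof -
  define h where "h i = poly (g i) (of_int n) * \<alpha> i powi n" for i
  have sh: "sum h {a + 1..a + b} = (\<Sum>i=1..b. h (a + i))" for a b
    using sum.shift_bounds_cl_nat_ivl[of h 1 a b] by (simp add: add.commute)
  have "{1..r1 + 2 * r2} = {1..r1} \<union> {r1 + 1..r1 + r2} \<union> {r1 + r2 + 1..r1 + r2 + r2}"
    by auto
  then have "sum h {1..r1 + 2 * r2} =
      sum h {1..r1} + sum h {r1 + 1..r1 + r2} + sum h {r1 + r2 + 1..r1 + r2 + r2}"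
    by (simp only:) (subst sum.union_disjoint; force simp: sum.union_disjoint)+
  also have "\<dots> = sum h {1..r1} + (\<Sum>i=1..r2. h (r1 + i) + h (r1 + r2 + i))"
    unfolding sh by (simp add: sum.distrib)
  finally have split: "sum h {1..r1 + 2 * r2} = \<dots>" .
  have real: "h i \<in> \<real>" if i: "i \<in> {1..r1}" for i
  proof -
    have "poly (g i) (of_int n) \<in> \<real>"
      using assms(2) i unfolding Xi_def poly_altdef by (auto intro!: sum_in_Reals)
    moreover have "\<alpha> i \<in> \<real>"
      using assms(1) i unfolding root_numbering_def by blast
    ultimately show "h i \<in> \<real>"
      unfolding h_def by (auto simp: power_int_def)
  qed
  have nonreal: "h (r1 + i) + h (r1 + r2 + i) \<in> \<real>" if i: "i \<in> {1..r2}" for i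
  proof -
    have "\<alpha> (r1 + r2 + i) = cnj (\<alpha> (r1 + i))"
      using assms(1) i unfolding root_numbering_def by blast
    moreover have "g (r1 + r2 + i) = map_poly cnj (g (r1 + i))"
      using assms(2) i unfolding Xi_def by auto
    moreover have "poly (map_poly cnj q) (of_int n) = cnj (poly q (of_int n))" for q
      by (induction q) (simp_all add: map_poly_pCons)
    moreover have "cnj z powi n = cnj (z powi n)" for z
      by (simp add: power_int_def)
    ultimately have "h (r1 + r2 + i) = cnj (h (r1 + i))"
      by (simp add: h_def)
    then show "h (r1 + i) + h (r1 + r2 + i) \<in> \<real>"
      by (simp add: complex_is_Real_iff)
  qed
  have "sum h {1..r1 + 2 * r2} \<in> \<real>"
    unfolding split by (rule Reals_add; rule sum_in_Reals; erule real nonreal)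
  then show ?thesis
    unfolding x_seq_def h_def by (rule of_real_Re)
qed

definition eps :: "real \<Rightarrow> real" where
  "eps x = x - of_int (round x)"

lemma eps_unique:
  "x = of_int u + e \<and> e \<in> {-1/2..<1/2} \<longleftrightarrow> u = round x \<and> e = eps x"
proof
  assume *: "x = of_int u + e \<and> e \<in> {-1/2..<1/2}"
  then have "round x = u"
    unfolding round_def by (intro floor_unique) auto
  with * show "u = round x \<and> e = eps x" by (simp add: eps_def)
next
  assume "u = round x \<and> e = eps x"
  then show "x = of_int u + e \<and> e \<in> {-1/2..<1/2}"
    using floor_correct[of "x + 1/2"] by (simp add: eps_def round_def) linarith
qed

definition E_set :: "nat \<Rightarrow> nat \<Rightarrow> (nat \<Rightarrow> complex) \<Rightarrow> nat \<Rightarrow> (int \<Rightarrow> real) set" where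
  "E_set r1 r2 \<alpha> k = (\<lambda>g m. eps (x_seq r1 r2 \<alpha> g m)) ` Xi r1 r2 k"

definition Omega0 :: "(int \<Rightarrow> int) set" where
  "Omega0 = {t. (\<exists>M<0. \<forall>m<M. t m = 0) \<and>
     (\<forall>c::real. c > 1 \<longrightarrow> (\<lambda>m. real_of_int (t m)) \<in> O[at_top](\<lambda>m. c powi m))}"

definition rho :: "int poly \<Rightarrow> real \<Rightarrow> int \<Rightarrow> complex" where
  "rho f r n = - 1 / (2 * of_real pi * \<i>) *
     contour_integral (circlepath 0 r) (\<lambda>z. z powi (n - 1) / poly (cpoly f) z)"

(* Bi-infinite matrices are functions of the row index and the column index. Convergence of sums
   over all integers is unconditional. *)
type_synonym bimatrix = "int \<Rightarrow> int \<Rightarrow> complex"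

definition mat_mult_defined :: "bimatrix \<Rightarrow> bimatrix \<Rightarrow> bool" where
  "mat_mult_defined A B \<longleftrightarrow> (\<forall>m n. (\<lambda>j. A m j * B j n) summable_on UNIV)"

definition mat_mult :: "bimatrix \<Rightarrow> bimatrix \<Rightarrow> bimatrix" where
  "mat_mult A B = (\<lambda>m n. \<Sum>\<^sub>\<infinity>j. A m j * B j n)"

definition mat_vec_defined :: "bimatrix \<Rightarrow> (int \<Rightarrow> complex) \<Rightarrow> bool" where
  "mat_vec_defined A y \<longleftrightarrow> (\<forall>m. (\<lambda>j. A m j * y j) summable_on UNIV)"

definition mat_vec :: "bimatrix \<Rightarrow> (int \<Rightarrow> complex) \<Rightarrow> int \<Rightarrow> complex" where
  "mat_vec A y = (\<lambda>m. \<Sum>\<^sub>\<infinity>j. A m j * y j)"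

definition is_inverse_matrix :: "bimatrix \<Rightarrow> bimatrix \<Rightarrow> bool" where
  "is_inverse_matrix B A \<longleftrightarrow>
     mat_mult_defined A B \<and> mat_mult A B = (\<lambda>m n. of_bool (m = n)) \<and>
     mat_mult_defined B A \<and> mat_mult B A = (\<lambda>m n. of_bool (m = n))"

definition A_mat :: "nat \<Rightarrow> int poly \<Rightarrow> bimatrix" where
  "A_mat D f = (\<lambda>m n. if 0 \<le> n - m \<and> n - m \<le> int D
                       then - of_int (coeff f (nat (n - m))) else 0)"

definition B_mat :: "int poly \<Rightarrow> real \<Rightarrow> bimatrix" where
  "B_mat f r = (\<lambda>m n. rho f r (m - n))"

end

theory Submission
  imports Defs
begin

text \<open>
  Let \<open>S\<close> be the shift on two-sided sequences, \<open>(S y) m = y (m + 1)\<close>. Multiplication by the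
  matrix \<open>A_mat D f\<close> is the operator \<open>- f(S)\<close>, so all three claims are about the difference
  equation \<open>f(S) y = - s\<close>. Call \<open>y\<close> tempered if \<open>y m = O(r\<^sup>m)\<close> in both directions.

  Two facts carry the proof. First, \<open>rho\<close> is a tempered fundamental solution: inserting
  \<open>f(S)\<close> under the contour integral cancels the denominator and leaves the integral of \<open>z
  powi (n - 1)\<close> (\<open>shift_op_rho\<close>), and the integral is at most a constant times \<open>r\<^sup>n\<close>
  (\<open>rho_bound\<close>). Second, \<open>f(S)\<close> is injective on tempered sequences, because \<open>f\<close> has no root
  of modulus \<open>r\<close>: peeling off one root \<open>b\<close> at a time leaves \<open>v (m + 1) = b * v m\<close>, and a
  nonzero sequence of this kind exceeds every multiple of \<open>r\<^sup>m\<close> at \<open>-\<infinity>\<close> if \<open>\<bar>b\<bar> < r\<close> and at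
  \<open>+\<infinity>\<close> if \<open>\<bar>b\<bar> > r\<close> (\<open>shift_op_kernel_trivial\<close>). Hence, whenever \<open>s n\<close> is absolutely
  summable with weight \<open>r powi (- n)\<close>, the product of \<open>B_mat f r\<close> and \<open>s\<close> exists and is the
  only tempered solution of \<open>f(S) y = - s\<close> (\<open>rho_convolution_unique\<close>).

  That the matrices are inverse to each other is the recurrence \<open>f(S) rho = - of_bool (n =
  0)\<close> read along the rows and the columns.

  For the reconstruction of the remainders: the sequence \<open>x\<close> lies in the kernel of \<open>f(S)\<close>.
  At \<open>-\<infinity>\<close> it is \<open>O(r\<^sup>m)\<close>, hence tends to \<open>0\<close> and coincides with its remainders \<open>\<epsilon>\<close>; so \<open>s =
  - f(S) \<epsilon>\<close> vanishes there, while at \<open>+\<infinity>\<close> both sequences are bounded. Thus \<open>\<epsilon>\<close> is the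
  tempered solution that belongs to \<open>s\<close>.

  For the congruence modulo the integers: if \<open>P\<close> is monic, the equation \<open>f(S) u = t\<close> is
  solved by an integer sequence \<open>u\<close> that vanishes near \<open>-\<infinity>\<close>, by recursion. If \<open>y\<close> is the
  product of \<open>B_mat f r\<close> and \<open>t\<close>, then \<open>z = y + u\<close> is congruent to \<open>y\<close> modulo the integers
  and lies in the kernel of \<open>f(S)\<close>. Since \<open>z m = O(r\<^sup>m)\<close> at \<open>-\<infinity>\<close>, the roots of modulus at
  most \<open>1\<close> can be peeled off, and what remains is an exponential polynomial in the roots of
  modulus greater than \<open>1\<close> (\<open>exp_poly_of_kernel\<close>). Averaging it with its complex conjugate
  puts its coefficients into \<open>Xi\<close>, since \<open>z\<close> is real.
\<close>

section \<open>Polynomials in the shift operator\<close>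

definition shift_op :: "'a::comm_ring_1 poly \<Rightarrow> (int \<Rightarrow> 'a) \<Rightarrow> int \<Rightarrow> 'a" where
  "shift_op p y m = (\<Sum>i\<le>degree p. coeff p i * y (m + int i))"

lemma shift_op_bound:
  assumes "degree p \<le> n"
  shows "shift_op p y m = (\<Sum>i\<le>n. coeff p i * y (m + int i))"
  unfolding shift_op_def
  by (rule sum.mono_neutral_left) (use assms in \<open>auto simp: coeff_eq_0\<close>)

lemma shift_op_0 [simp]: "shift_op 0 y m = 0"
  by (simp add: shift_op_def)

lemma shift_op_pCons: "shift_op (pCons a p) y m = a * y m + shift_op p y (m + 1)"
  unfolding shift_op_bound[OF degree_pCons_le] shift_op_def[of p]
  by (simp add: sum.atMost_Suc_shift algebra_simps del: sum.atMost_Suc)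

lemma shift_op_1 [simp]: "shift_op 1 y = y"
  by (simp add: fun_eq_iff shift_op_def)

lemma shift_op_add_poly: "shift_op (p + q) y m = shift_op p y m + shift_op q y m"
  using shift_op_bound[of p "max (degree p) (degree q)" y m]
    shift_op_bound[of q "max (degree p) (degree q)" y m]
    shift_op_bound[of "p + q" "max (degree p) (degree q)" y m] degree_add_le_max[of p q]
  by (simp add: sum.distrib algebra_simps)

lemma shift_op_smult: "shift_op (smult a p) y m = a * shift_op p y m"
  using shift_op_bound[of "smult a p" "degree p" y m] degree_smult_le[of a p]
  by (simp add: shift_op_def sum_distrib_left mult.assoc)

lemma shift_op_add: "shift_op p (\<lambda>m. y m + z m) m = shift_op p y m + shift_op p z m"
  by (simp add: shift_op_def sum.distrib algebra_simps)

lemma shift_op_diff: "shift_op p (\<lambda>m. y m - z m) m = shift_op p y m - shift_op p z m"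
  by (simp add: shift_op_def sum_subtractf algebra_simps)

lemma shift_op_sum: "shift_op p (\<lambda>m. \<Sum>i\<in>I. y i m) m = (\<Sum>i\<in>I. shift_op p (y i) m)"
  unfolding shift_op_def sum_distrib_left by (rule sum.swap)

lemma shift_op_zero_seq [simp]: "shift_op p (\<lambda>_. 0) = (\<lambda>_. 0)"
  by (simp add: fun_eq_iff shift_op_def)

lemma shift_op_mult: "shift_op (p * q) y = shift_op p (shift_op q y)"
proof (induction p)
  case (pCons a p)
  show ?case
    by (rule ext) (simp add: shift_op_pCons shift_op_add_poly shift_op_smult pCons.IH)
qed (simp add: fun_eq_iff)

lemma shift_op_linear: "shift_op [:- b, 1:] y m = y (m + 1) - b * y m"
  by (simp add: shift_op_pCons)

lemma shift_op_of_int: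
  "shift_op (map_poly of_int p) (\<lambda>m. of_int (y m)) m = of_int (shift_op p y m)"
  by (subst shift_op_bound[OF map_poly_degree_leq]) (simp add: shift_op_def coeff_map_poly)

lemma shift_op_cnj: "shift_op (cpoly p) (\<lambda>m. cnj (y m)) m = cnj (shift_op (cpoly p) y m)"
  by (simp add: shift_op_def coeff_map_poly)

lemma cpoly_mult: "cpoly (p * q) = cpoly p * cpoly q"
  by (intro poly_eqI) (simp add: coeff_map_poly coeff_mult)

lemma cpoly_power: "cpoly (p ^ n) = cpoly p ^ n"
  by (induction n) (simp_all add: cpoly_mult)

section \<open>Uniqueness of solutions of geometric growth\<close>

abbreviation geometric :: "real \<Rightarrow> int \<Rightarrow> complex" where
  "geometric r \<equiv> \<lambda>m. of_real r powi m"

lemma shift_bigo_geometric: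
  assumes "F = at_bot \<or> F = at_top" "r > 0" "y \<in> O[F](geometric r)"
  shows "(\<lambda>m. y (m + int i)) \<in> O[F](geometric r)"
proof -
  have "filterlim (\<lambda>m. m + int i) F F"
    using assms(1)
  proof
    assume F: "F = at_bot"
    have "\<forall>\<^sub>F m in at_bot. m + int i \<le> Z" for Z :: int
      by (rule eventually_at_bot_linorderI[of "Z - int i"]) auto
    then show ?thesis unfolding F filterlim_at_bot by blast
  next
    assume F: "F = at_top"
    have "\<forall>\<^sub>F m in at_top. m + int i \<ge> Z" for Z :: int
      by (rule eventually_at_top_linorderI[of "Z - int i"]) auto
    then show ?thesis unfolding F filterlim_at_top by blast
  qed
  with assms(3) have "(\<lambda>m. y (m + int i)) \<in> O[F](\<lambda>m. geometric r (m + int i))"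
    by (rule landau_o.big.compose)
  also have "(\<lambda>m. geometric r (m + int i)) = (\<lambda>m. of_real r ^ i * geometric r m)"
    using assms(2) by (simp add: fun_eq_iff power_int_add)
  also have "O[F](\<dots>) = O[F](geometric r)"
    using assms(2) by simp
  finally show ?thesis .
qed

lemma shift_op_bigo_geometric:
  assumes "F = at_bot \<or> F = at_top" "r > 0" "y \<in> O[F](geometric r)"
  shows "shift_op p y \<in> O[F](geometric r)"
  unfolding shift_op_def[abs_def]
  by (intro big_sum_in_bigo) (simp add: shift_bigo_geometric[OF assms])

lemma geometric_shift:
  fixes v :: "int \<Rightarrow> complex"
  assumes "\<And>m. v (m + 1) = b * v m"
  shows "v (m + int n) = b ^ n * v m"
proof (induction n)
  case (Suc n)
  have "v (m + int (Suc n)) = v ((m + int n) + 1)" by (simp add: algebra_simps)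
  then show ?case by (simp add: assms Suc.IH)
qed simp

text \<open>
  A geometric sequence with ratio \<open>b\<close> satisfies \<open>\<bar>v m\<bar> = \<bar>b\<bar>\<^sup>n \<bar>v (m - n)\<bar>\<close>; against a bound by \<open>r\<^sup>m\<close> this
  gives \<open>\<bar>v m\<bar> \<le> const * (\<bar>b\<bar> / r)\<^sup>n\<close>, which tends to zero. The other direction uses \<open>v (m + n)\<close>.
\<close>
lemma geometric_eq_zero:
  fixes v :: "int \<Rightarrow> complex"
  assumes r: "r > 0" and v: "\<And>m. v (m + 1) = b * v m"
    and "cmod b < r \<and> v \<in> O[at_bot](geometric r) \<or> cmod b > r \<and> v \<in> O[at_top](geometric r)"
  shows "v m = 0"
  using assms(3)
proof
  assume *: "cmod b < r \<and> v \<in> O[at_bot](geometric r)"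
  then obtain c where "\<forall>\<^sub>F m in at_bot. cmod (v m) \<le> c * cmod (geometric r m)"
    by (auto elim: landau_o.bigE)
  then obtain N where N: "\<And>m. m \<le> N \<Longrightarrow> cmod (v m) \<le> c * r powi m"
    using r by (auto simp: eventually_at_bot_linorder norm_power_int)
  have "\<forall>\<^sub>F n in sequentially. cmod (v m) \<le> c * r powi m * (cmod b / r) ^ n"
  proof (rule eventually_sequentiallyI[of "nat (m - N)"])
    fix n assume n: "nat (m - N) \<le> n"
    have "cmod (v m) = cmod b ^ n * cmod (v (m - int n))"
      using geometric_shift[of v b "m - int n" n] v by (simp add: norm_mult norm_power)
    also have "\<dots> \<le> cmod b ^ n * (c * r powi (m - int n))"
      using n by (intro mult_left_mono N) auto
    also have "\<dots> = c * r powi m * (cmod b / r) ^ n"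
      using r by (simp add: power_int_diff power_divide)
    finally show "cmod (v m) \<le> c * r powi m * (cmod b / r) ^ n" .
  qed
  moreover have "(\<lambda>n. c * r powi m * (cmod b / r) ^ n) \<longlonglongrightarrow> c * r powi m * 0"
    using * r by (intro tendsto_intros LIMSEQ_power_zero) auto
  ultimately have "cmod (v m) \<le> c * r powi m * 0"
    by (intro tendsto_lowerbound[of _ _ sequentially]) auto
  then show ?thesis by simp
next
  assume *: "cmod b > r \<and> v \<in> O[at_top](geometric r)"
  then have b: "cmod b > 0" using r by linarith
  from * obtain c where "\<forall>\<^sub>F m in at_top. cmod (v m) \<le> c * cmod (geometric r m)"
    by (auto elim: landau_o.bigE)
  then obtain N where N: "\<And>m. m \<ge> N \<Longrightarrow> cmod (v m) \<le> c * r powi m"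
    using r by (auto simp: eventually_at_top_linorder norm_power_int)
  have "\<forall>\<^sub>F n in sequentially. cmod (v m) \<le> c * r powi m * (r / cmod b) ^ n"
  proof (rule eventually_sequentiallyI[of "nat (N - m)"])
    fix n assume n: "nat (N - m) \<le> n"
    have "cmod b ^ n * cmod (v m) = cmod (v (m + int n))"
      using geometric_shift[of v b m n] v by (simp add: norm_mult norm_power)
    also have "\<dots> \<le> c * r powi (m + int n)"
      using n by (intro N) auto
    finally show "cmod (v m) \<le> c * r powi m * (r / cmod b) ^ n"
      using r b by (simp add: power_int_add power_divide field_simps)
  qed
  moreover have "(\<lambda>n. c * r powi m * (r / cmod b) ^ n) \<longlonglongrightarrow> c * r powi m * 0"
    using * r b by (intro tendsto_intros LIMSEQ_power_zero) auto
  ultimately have "cmod (v m) \<le> c * r powi m * 0"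
    by (intro tendsto_lowerbound[of _ _ sequentially]) auto
  then show ?thesis by simp
qed

text \<open>
  Induction on the degree: if \<open>p = (X - b) q\<close>, then \<open>(S - b) y\<close> has the same growth as \<open>y\<close> and is in the
  kernel of \<open>q(S)\<close>, hence zero, so that \<open>y\<close> is geometric with ratio \<open>b\<close>. Growth at \<open>+\<infinity>\<close> is only
  demanded in the presence of roots outside the circle; this serves sequences whose growth
  is controlled at \<open>-\<infinity>\<close> only.
\<close>
lemma shift_op_kernel_trivial:
  fixes p :: "complex poly" and y :: "int \<Rightarrow> complex"
  assumes r: "r > 0" and "p \<noteq> 0" and "shift_op p y = (\<lambda>_. 0)"
    and bot: "y \<in> O[at_bot](geometric r)"
    and "\<And>z. poly p z = 0 \<Longrightarrow> cmod z \<noteq> r"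
    and "\<And>z. poly p z = 0 \<Longrightarrow> cmod z > r \<Longrightarrow> y \<in> O[at_top](geometric r)"
  shows "y = (\<lambda>_. 0)"
  using assms(2-)
proof (induction "degree p" arbitrary: p y)
  case 0
  then obtain c where "p = [:c:]" "c \<noteq> 0"
    by (metis degree_eq_zeroE pCons_0_0)
  with 0 show ?case by (simp add: shift_op_def fun_eq_iff)
next
  case (Suc n p)
  then obtain b where b: "poly p b = 0"
    by (metis alg_closed_imp_poly_has_root zero_less_Suc)
  then obtain q where q: "p = [:- b, 1:] * q"
    by (auto simp: poly_eq_0_iff_dvd elim: dvdE)
  have q0: "q \<noteq> 0" using Suc.prems q by auto
  have deg: "degree q = n"
    using Suc.hyps(2) q0 unfolding q by (subst (asm) degree_mult_eq) auto
  have root: "poly p z = 0" if "poly q z = 0" for z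
    using that by (simp add: q)
  let ?v = "shift_op [:- b, 1:] y"
  have "?v = (\<lambda>_. 0)"
  proof (rule Suc.hyps(1)[of q])
    show "shift_op q ?v = (\<lambda>_. 0)"
      using Suc.prems(2) by (simp only: q mult.commute[of _ q] shift_op_mult)
  qed (use deg q0 Suc.prems root r in \<open>auto intro!: shift_op_bigo_geometric\<close>)
  then have step: "y (m + 1) = b * y m" for m
    by (simp add: fun_eq_iff shift_op_linear)
  show ?case
  proof
    fix m
    from Suc.prems(4)[OF b] consider "cmod b < r" | "cmod b > r" by linarith
    then show "y m = 0"
      by cases (rule geometric_eq_zero[OF r, of y b]; use step Suc.prems b in auto)+
  qed
qed

section \<open>Exponential polynomials\<close>

lemma coeff_pcompose_shift_top:
  fixes h :: "complex poly"
  assumes "degree h \<le> j"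
  shows "coeff (h \<circ>\<^sub>p [:1, 1:]) j = coeff h j"
proof (cases "j = degree h")
  case True
  have "degree (h \<circ>\<^sub>p [:1, 1:]) = degree h" by (simp add: degree_pcompose)
  then show ?thesis
    using lead_coeff_comp[of "[:1, 1:]" h] True by simp
next
  case False
  with assms show ?thesis by (simp add: coeff_eq_0 degree_pcompose)
qed

lemma shift_op_linear_exp_poly:
  fixes h :: "complex poly"
  assumes "b \<noteq> 0"
  shows "shift_op [:- c, 1:] (\<lambda>m. poly h (of_int m) * b powi m) =
    (\<lambda>m. poly (smult b (h \<circ>\<^sub>p [:1, 1:]) - smult c h) (of_int m) * b powi m)"
  using assms by (simp add: fun_eq_iff shift_op_linear poly_pcompose power_int_add algebra_simps)

text \<open>
  Applying \<open>S - b\<close> to \<open>h(m) b\<^sup>m\<close> replaces \<open>h\<close> by \<open>b (h(m + 1) - h(m))\<close>, whose degree is smaller.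
\<close>
lemma shift_op_power_exp_poly_eq_0:
  fixes h :: "complex poly"
  assumes b: "b \<noteq> 0" and "\<And>j. j \<ge> n \<Longrightarrow> coeff h j = 0"
  shows "shift_op ([:- b, 1:] ^ n) (\<lambda>m. poly h (of_int m) * b powi m) = (\<lambda>_. 0)"
  using assms(2)
proof (induction n arbitrary: h)
  case 0
  then have "h = 0" by (simp add: poly_eq_iff)
  then show ?case by simp
next
  case (Suc n)
  have deg: "degree h \<le> n"
    using Suc.prems by (intro degree_le) auto
  have "shift_op ([:- b, 1:] ^ n)
      (\<lambda>m. poly (smult b (h \<circ>\<^sub>p [:1, 1:]) - smult b h) (of_int m) * b powi m) = (\<lambda>_. 0)"
    by (rule Suc.IH) (use deg in \<open>simp add: coeff_pcompose_shift_top\<close>)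
  moreover have "[:- b, 1:] ^ Suc n = [:- b, 1:] ^ n * [:- b, 1:]"
    by (rule power_Suc2)
  ultimately show ?case
    by (simp only: shift_op_mult shift_op_linear_exp_poly[OF b])
qed

text \<open>
  On polynomials the operator \<open>h \<mapsto> a h(x + 1) - b h(x)\<close> preserves the degree if \<open>a \<noteq> b\<close> and lowers it by
  exactly one if \<open>a = b\<close> (the resonant case). So the leading term of \<open>q\<close> can be matched by a
  multiple of the image of one monomial, and the rest has smaller degree.
\<close>
lemma difference_equation:
  fixes a b :: complex and q :: "complex poly"
  assumes a: "a \<noteq> 0" and "\<And>j. j \<ge> n \<Longrightarrow> coeff q j = 0"
  shows "\<exists>h. (\<forall>j\<ge>n + of_bool (a = b). coeff h j = 0) \<and>
    smult a (h \<circ>\<^sub>p [:1, 1:]) - smult b h = q"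
  using assms(2)
proof (induction n arbitrary: q)
  case 0
  then have "q = 0" by (simp add: poly_eq_iff)
  then show ?case by (intro exI[of _ 0]) simp
next
  case (Suc n)
  define N where "N = n + of_bool (a = b)"
  define T where "T h = smult a (h \<circ>\<^sub>p [:1, 1:]) - smult b h" for h
  define e where "e = T (monom 1 N)"
  have comp: "monom 1 N \<circ>\<^sub>p [:1, 1::complex:] = [:1, 1:] ^ N"
    by (induction N) (simp_all add: monom_Suc pcompose_pCons pcompose_1)
  have high: "coeff e j = 0" if "j \<ge> Suc n" for j
  proof (cases "j \<ge> N")
    case True
    then show ?thesis
      using that coeff_pcompose_shift_top[of "monom 1 N" j] degree_monom_le[of "1::complex" N]
      by (auto simp: e_def T_def N_def)
  next
    case False
    then show ?thesis using that by (cases "a = b") (auto simp: N_def)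
  qed
  \<comment> \<open>The coefficient of \<open>e\<close> at \<open>n\<close> is \<open>a - b\<close> if \<open>a \<noteq> b\<close> and \<open>a * (n + 1)\<close> otherwise.\<close>
  have "coeff (monom 1 N \<circ>\<^sub>p [:1, 1::complex:]) n = of_nat (N choose n)"
    unfolding comp by (subst coeff_linear_poly_power) (simp_all add: N_def)
  then have low: "coeff e n \<noteq> 0"
    using a by (cases "a = b") (auto simp: e_def T_def N_def simp del: of_nat_Suc)
  define c where "c = coeff q n / coeff e n"
  have "coeff (q - smult c e) j = 0" if "j \<ge> n" for j
    using that high[of j] Suc.prems[of j] low by (cases "j = n") (auto simp: c_def)
  then obtain h where h: "\<And>j. j \<ge> N \<Longrightarrow> coeff h j = 0" "T h = q - smult c e"
    using Suc.IH[of "q - smult c e"] unfolding N_def T_def by blast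
  have "T (h + smult c (monom 1 N)) = T h + smult c e"
    by (simp add: T_def e_def pcompose_add pcompose_smult algebra_simps smult_add_right smult_diff_right)
  with h have "T (h + smult c (monom 1 N)) = q" by simp
  moreover have "coeff (h + smult c (monom 1 N)) j = 0" if "j \<ge> Suc n + of_bool (a = b)" for j
    using that h(1)[of j] by (auto simp: N_def)
  ultimately show ?case unfolding T_def by blast
qed

lemma geometric_powi:
  fixes w :: "int \<Rightarrow> complex"
  assumes "c \<noteq> 0" "\<And>m. w (m + 1) = c * w m"
  shows "w m = w 0 * c powi m"
proof (cases "m \<ge> 0")
  case True
  then show ?thesis
    using geometric_shift[of w c 0 "nat m"] assms(2) by (simp add: power_int_def)
next
  case False
  then show ?thesis
    using geometric_shift[of w c m "nat (- m)"] assms by (simp add: power_int_def field_simps)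
qed

text \<open>
  The general solution of a homogeneous linear recurrence. Induction on the number of factors:
  splitting off \<open>S - c\<close>, the sequence \<open>(S - c) y\<close> is an exponential polynomial by induction; solving
  the difference equation for each of its terms gives a particular solution \<open>u\<close>, resonant only
  for the term of \<open>c\<close> itself, and \<open>y - u\<close> is geometric with ratio \<open>c\<close>.
\<close>
lemma exp_poly_of_kernel:
  fixes R :: "complex set" and y :: "int \<Rightarrow> complex"
  assumes R: "finite R" "0 \<notin> R" and "shift_op (\<Prod>b\<in>R. [:- b, 1:] ^ e b) y = (\<lambda>_. 0)"
  shows "\<exists>h. (\<forall>b\<in>R. \<forall>j\<ge>e b. coeff (h b) j = 0) \<and>
    (\<forall>m. y m = (\<Sum>b\<in>R. poly (h b) (of_int m) * b powi m))"
  using assms(3)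
proof (induction "sum e R" arbitrary: e y)
  case 0
  then have "\<forall>b\<in>R. e b = 0" using R by simp
  then have "(\<Prod>b\<in>R. [:- b, 1:] ^ e b) = 1" by simp
  with 0 have "y = (\<lambda>_. 0)" by simp
  then show ?case by (intro exI[of _ "\<lambda>_. 0"]) simp
next
  case (Suc n)
  then have "sum e R \<noteq> 0" by simp
  then obtain c where c: "c \<in> R" "e c > 0" using R by auto
  with R have c0: "c \<noteq> 0" by auto
  define e' where "e' = e(c := e c - 1)"
  have e'_plus: "e' b + of_bool (b = c) = e b" for b
    using c by (simp add: e'_def)
  have "sum e R = sum e' R + (\<Sum>b\<in>R. of_bool (b = c))"
    by (simp flip: sum.distrib e'_plus)
  then have n: "n = sum e' R"
    using Suc.hyps(2) c R by (simp add: of_bool_def)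
  have "(\<Prod>b\<in>R. [:- b, 1:] ^ e b) = (\<Prod>b\<in>R. [:- b, 1:] ^ e' b) * (\<Prod>b\<in>R. [:- b, 1:] ^ of_bool (b = c))"
    by (simp flip: prod.distrib power_add e'_plus)
  also have "(\<Prod>b\<in>R. [:- b, 1:] ^ of_bool (b = c)) = (\<Prod>b\<in>R. if b = c then [:- c, 1:] else 1)"
    by (rule prod.cong) auto
  also have "\<dots> = [:- c, 1:]"
    using c R by simp
  finally have fact: "(\<Prod>b\<in>R. [:- b, 1:] ^ e b) = (\<Prod>b\<in>R. [:- b, 1:] ^ e' b) * [:- c, 1:]" .
  define v where "v = shift_op [:- c, 1:] y"
  have "shift_op (\<Prod>b\<in>R. [:- b, 1:] ^ e' b) v = (\<lambda>_. 0)"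
    using Suc.prems unfolding fact shift_op_mult v_def .
  from Suc.hyps(1)[OF n this] obtain h where
    h: "\<And>b j. b \<in> R \<Longrightarrow> j \<ge> e' b \<Longrightarrow> coeff (h b) j = 0"
       "\<And>m. v m = (\<Sum>b\<in>R. poly (h b) (of_int m) * b powi m)" by auto
  have "\<forall>b\<in>R. \<exists>H. (\<forall>j\<ge>e b. coeff H j = 0) \<and> smult b (H \<circ>\<^sub>p [:1, 1:]) - smult c H = h b"
  proof
    fix b assume b: "b \<in> R"
    then have "b \<noteq> 0" using R by auto
    from difference_equation[where b = c and n = "e' b" and q = "h b", OF this] h(1)[OF b]
    show "\<exists>H. (\<forall>j\<ge>e b. coeff H j = 0) \<and> smult b (H \<circ>\<^sub>p [:1, 1:]) - smult c H = h b"
      by (simp add: e'_plus)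
  qed
  then obtain H where H: "\<And>b j. b \<in> R \<Longrightarrow> j \<ge> e b \<Longrightarrow> coeff (H b) j = 0"
      "\<And>b. b \<in> R \<Longrightarrow> smult b (H b \<circ>\<^sub>p [:1, 1:]) - smult c (H b) = h b"
    by metis
  define u where "u m = (\<Sum>b\<in>R. poly (H b) (of_int m) * b powi m)" for m
  have u_v: "shift_op [:- c, 1:] u m = v m" for m
  proof -
    have "shift_op [:- c, 1:] u m =
        (\<Sum>b\<in>R. shift_op [:- c, 1:] (\<lambda>m. poly (H b) (of_int m) * b powi m) m)"
      unfolding u_def[abs_def] by (rule shift_op_sum)
    also have "\<dots> = (\<Sum>b\<in>R. poly (h b) (of_int m) * b powi m)"
    proof (rule sum.cong)
      fix b assume b: "b \<in> R"
      then have "b \<noteq> 0" using R by auto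
      from shift_op_linear_exp_poly[OF this]
      show "shift_op [:- c, 1:] (\<lambda>m. poly (H b) (of_int m) * b powi m) m =
          poly (h b) (of_int m) * b powi m"
        by (simp only: H(2)[OF b])
    qed simp
    finally show ?thesis by (simp add: h)
  qed
  have "y (m + 1) - u (m + 1) = c * (y m - u m)" for m
    using u_v[of m] by (simp add: v_def shift_op_linear algebra_simps)
  then have w: "y m - u m = (y 0 - u 0) * c powi m" for m
    using geometric_powi[of c "\<lambda>m. y m - u m" m] c0 by blast
  define G where "G = H(c := H c + [:y 0 - u 0:])"
  have "y m = (\<Sum>b\<in>R. poly (G b) (of_int m) * b powi m)" for m
  proof -
    have "(\<Sum>b\<in>R. poly (G b) (of_int m) * b powi m) =
        (\<Sum>b\<in>R. poly (H b) (of_int m) * b powi m + (if b = c then (y 0 - u 0) * c powi m else 0))"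
      by (rule sum.cong) (auto simp: G_def algebra_simps)
    also have "\<dots> = u m + (y 0 - u 0) * c powi m"
      using c R by (simp add: sum.distrib u_def)
    also have "\<dots> = y m"
      by (simp flip: w)
    finally show ?thesis by simp
  qed
  moreover have "coeff (G b) j = 0" if "b \<in> R" "j \<ge> e b" for b j
    using that H(1) c by (auto simp: G_def coeff_pCons split: nat.split)
  ultimately show ?case by blast
qed

section \<open>The fundamental solution\<close>

lemma contour_integral_circlepath_powi:
  assumes "r > 0"
  shows "((\<lambda>z. z powi (n - 1)) has_contour_integral (if n = 0 then 2 * of_real pi * \<i> else 0))
    (circlepath 0 r)"
proof (cases "n = 0")
  case True
  have "(\<lambda>w. 1 / w) contour_integrable_on circlepath 0 r"
    using assms by (intro contour_integrable_continuous_circlepath continuous_intros) auto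
  then have "((\<lambda>w. 1 / w) has_contour_integral 2 * of_real pi * \<i>) (circlepath 0 r)"
    using contour_integral_circlepath[OF assms, of 0]
      has_contour_integral_integral[of "\<lambda>w. 1 / w" "circlepath 0 r"] by simp
  then show ?thesis
    using True by (simp add: power_int_minus divide_inverse)
next
  case False
  have "((\<lambda>z. z powi (n - 1)) has_contour_integral 0) (circlepath 0 r)"
  proof (rule Cauchy_theorem_primitive[of "- {0}" "\<lambda>z. z powi n / of_int n"])
    show "((\<lambda>z. z powi n / of_int n) has_field_derivative z powi (n - 1)) (at z within - {0})"
      if "z \<in> - {0}" for z :: complex
      using that False by (auto intro!: derivative_eq_intros)
  qed (use assms in auto)
  then show ?thesis using False by simp
qed

context
  fixes f :: "int poly" and r :: real
  assumes r: "r > 0" and nz: "\<forall>z. cmod z = r \<longrightarrow> poly (cpoly f) z \<noteq> 0"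
begin

lemma rho_integrand:
  "((\<lambda>z. z powi (n - 1) / poly (cpoly f) z) has_contour_integral
     (- 2 * of_real pi * \<i>) * rho f r n) (circlepath 0 r)"
proof -
  have "(\<lambda>z. z powi (n - 1) / poly (cpoly f) z) contour_integrable_on circlepath 0 r"
    using r nz by (intro contour_integrable_continuous_circlepath continuous_intros) auto
  then show ?thesis
    by (simp add: has_contour_integral_integral rho_def)
qed

text \<open>
  Under the integral, \<open>f(S)\<close> acts on \<open>n \<mapsto> z powi (n - 1)\<close> as multiplication by \<open>f z\<close>, which cancels
  the denominator.
\<close>
lemma shift_op_rho: "shift_op (cpoly f) (rho f r) n = - of_bool (n = 0)"
proof -
  let ?F = "cpoly f" and ?c = "- 2 * of_real pi * \<i>"
  have "((\<lambda>z. \<Sum>i\<le>degree ?F. coeff ?F i * (z powi (n + int i - 1) / poly ?F z)) has_contour_integral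
      (\<Sum>i\<le>degree ?F. coeff ?F i * (?c * rho f r (n + int i)))) (circlepath 0 r)"
    by (intro has_contour_integral_sum has_contour_integral_lmul rho_integrand) auto
  moreover have "(\<Sum>i\<le>degree ?F. coeff ?F i * (z powi (n + int i - 1) / poly ?F z)) = z powi (n - 1)"
    if "z \<in> path_image (circlepath 0 r)" for z
  proof -
    have "cmod z = r" using that r by auto
    then have z: "z \<noteq> 0" "poly ?F z \<noteq> 0" using r nz by auto
    have "(\<Sum>i\<le>degree ?F. coeff ?F i * (z powi (n + int i - 1) / poly ?F z)) =
        (\<Sum>i\<le>degree ?F. coeff ?F i * z ^ i * (z powi (n - 1) / poly ?F z))"
    proof (rule sum.cong)
      fix i
      have "z powi (n + int i - 1) = z powi (n - 1) * z ^ i"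
        using z power_int_add[of z "n - 1" "int i"] by (simp add: add_diff_eq add.commute)
      then show "coeff ?F i * (z powi (n + int i - 1) / poly ?F z) =
          coeff ?F i * z ^ i * (z powi (n - 1) / poly ?F z)" by simp
    qed simp
    also have "\<dots> = poly ?F z * (z powi (n - 1) / poly ?F z)"
      by (simp only: poly_altdef sum_distrib_right)
    finally show ?thesis using z by simp
  qed
  ultimately have "((\<lambda>z. z powi (n - 1)) has_contour_integral
      (\<Sum>i\<le>degree ?F. coeff ?F i * (?c * rho f r (n + int i)))) (circlepath 0 r)"
    by (rule has_contour_integral_eq)
  from contour_integral_unique[OF this]
    contour_integral_unique[OF contour_integral_circlepath_powi[OF r, of n]]
  have sum: "(\<Sum>i\<le>degree ?F. coeff ?F i * (?c * rho f r (n + int i))) =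
      (if n = 0 then 2 * of_real pi * \<i> else 0)"
    by (rule trans[OF sym])
  have "(\<Sum>i\<le>degree ?F. coeff ?F i * (?c * rho f r (n + int i))) =
      ?c * shift_op ?F (rho f r) n"
    by (simp add: shift_op_def sum_distrib_left mult_ac)
  moreover have "(if n = 0 then 2 * of_real pi * \<i> else 0) = ?c * (- of_bool (n = 0))"
    by simp
  ultimately have "?c * shift_op ?F (rho f r) n = ?c * (- of_bool (n = 0))"
    using sum by (elim trans[OF trans[OF sym]])
  then show ?thesis
    by (rule mult_left_cancel[THEN iffD1, rotated]) simp
qed

lemma rho_bound: "\<exists>C\<ge>0. \<forall>n. cmod (rho f r n) \<le> C * r powi n"
proof -
  have "compact ((\<lambda>z. inverse (poly (cpoly f) z)) ` sphere 0 r)"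
    using nz by (intro compact_continuous_image continuous_intros) auto
  then obtain B where "\<forall>z\<in>sphere 0 r. cmod (inverse (poly (cpoly f) z)) \<le> B"
    by (auto dest!: compact_imp_bounded simp: bounded_iff)
  then have B: "cmod (inverse (poly (cpoly f) z)) \<le> B" if "cmod z = r" for z
    using that by simp
  have B0: "B \<ge> 0"
    by (rule order.trans[OF norm_ge_zero B[of "of_real r"]]) (use r in simp)
  have "cmod (rho f r n) \<le> B * r powi n" for n
  proof -
    have "cmod ((- 2 * of_real pi * \<i>) * rho f r n) \<le> r powi (n - 1) * B * (2 * pi * r)"
    proof (rule has_contour_integral_bound_circlepath[OF rho_integrand])
      fix z assume "cmod (z - 0) = r"
      then show "cmod (z powi (n - 1) / poly (cpoly f) z) \<le> r powi (n - 1) * B"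
        using B[of z] r by (simp add: norm_mult norm_power_int divide_inverse mult_left_mono)
    qed (use r B0 in auto)
    also have "\<dots> = 2 * pi * (B * r powi n)"
      using r by (simp add: power_int_diff)
    finally show ?thesis by (simp add: norm_mult)
  qed
  with B0 show ?thesis by blast
qed

context
  fixes s :: "int \<Rightarrow> complex"
  assumes weight: "(\<lambda>n. cmod (s n) * r powi (- n)) summable_on UNIV"
begin

text \<open>
  The weight matches the bound \<open>\<bar>rho (m - n)\<bar> \<le> C * r powi m * r powi (- n)\<close>: it makes the convolution
  converge absolutely, and its sum inherits the factor \<open>r powi m\<close>.
\<close>
lemma rho_convolution_summable: "(\<lambda>n. cmod (rho f r (m - n) * s n)) summable_on UNIV"
  and rho_convolution_bigo: "mat_vec (B_mat f r) s \<in> O[F](geometric r)"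
proof -
  obtain C where C: "C \<ge> 0" "\<And>n. cmod (rho f r n) \<le> C * r powi n"
    using rho_bound by blast
  have le: "cmod (rho f r (m - n) * s n) \<le> C * r powi m * (cmod (s n) * r powi (- n))" for m n
  proof -
    have "cmod (rho f r (m - n) * s n) \<le> C * r powi (m - n) * cmod (s n)"
      unfolding norm_mult by (intro mult_right_mono C) auto
    then show ?thesis
      using r by (simp add: power_int_diff power_int_minus field_simps)
  qed
  have dom: "(\<lambda>n. C * r powi m * (cmod (s n) * r powi (- n))) summable_on UNIV" for m
    by (intro summable_on_cmult_right weight)
  show sm: "(\<lambda>n. cmod (rho f r (m - n) * s n)) summable_on UNIV" for m
    by (rule summable_on_comparison_test[OF dom le]) simp
  have "cmod (mat_vec (B_mat f r) s m) \<le>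
      C * (\<Sum>\<^sub>\<infinity>n. cmod (s n) * r powi (- n)) * cmod (geometric r m)" for m
  proof -
    have "cmod (mat_vec (B_mat f r) s m) \<le> (\<Sum>\<^sub>\<infinity>n. cmod (rho f r (m - n) * s n))"
      unfolding mat_vec_def B_mat_def by (rule norm_infsum_bound[OF sm])
    also have "\<dots> \<le> (\<Sum>\<^sub>\<infinity>n. C * r powi m * (cmod (s n) * r powi (- n)))"
      by (intro infsum_mono sm dom le)
    also have "\<dots> = C * r powi m * (\<Sum>\<^sub>\<infinity>n. cmod (s n) * r powi (- n))"
      by (rule infsum_cmult_right) (use weight in simp)
    finally show ?thesis using r by (simp add: norm_power_int mult_ac)
  qed
  then show "mat_vec (B_mat f r) s \<in> O[F](geometric r)"
    by (intro bigoI[of _ "C * (\<Sum>\<^sub>\<infinity>n. cmod (s n) * r powi (- n))"] always_eventually) auto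
qed

lemma rho_convolution_defined: "mat_vec_defined (B_mat f r) s"
  unfolding mat_vec_defined_def B_mat_def
  by (rule allI, rule abs_summable_summable, rule rho_convolution_summable)

lemma shift_op_rho_convolution: "shift_op (cpoly f) (mat_vec (B_mat f r) s) m = - s m"
proof -
  let ?y = "mat_vec (B_mat f r) s"
  have y: "((\<lambda>n. rho f r (m - n) * s n) has_sum ?y m) UNIV" for m
    using rho_convolution_defined
    unfolding mat_vec_defined_def mat_vec_def B_mat_def by (auto intro: has_sum_infsum)
  \<comment> \<open>Convolution commutes with every polynomial in the shift.\<close>
  have "((\<lambda>n. shift_op p (rho f r) (m - n) * s n) has_sum shift_op p ?y m) UNIV" for p m
  proof (induction p arbitrary: m)
    case (pCons a p)
    have "((\<lambda>n. a * (rho f r (m - n) * s n) + shift_op p (rho f r) (m + 1 - n) * s n) has_sum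
        (a * ?y m + shift_op p ?y (m + 1))) UNIV"
      by (intro has_sum_add has_sum_cmult_right y pCons.IH)
    then show ?case
      by (simp add: shift_op_pCons algebra_simps)
  qed simp
  from this[of "cpoly f" m]
  have "((\<lambda>n. - of_bool (m = n) * s n) has_sum shift_op (cpoly f) ?y m) UNIV"
    by (simp add: shift_op_rho)
  moreover have "((\<lambda>n. - of_bool (m = n) * s n) has_sum (- s m)) UNIV"
    by (rule has_sum_finite_neutralI[of "{m}"]) auto
  ultimately show ?thesis by (rule has_sum_unique)
qed

text \<open>
  The difference of two tempered solutions is a tempered element of the kernel of \<open>f(S)\<close>.
\<close>
lemma rho_convolution_unique:
  assumes "f \<noteq> 0" "\<And>m. shift_op (cpoly f) y m = - s m"
    and "y \<in> O[at_bot](geometric r)" "y \<in> O[at_top](geometric r)"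
  shows "mat_vec (B_mat f r) s = y"
proof -
  have "(\<lambda>m. mat_vec (B_mat f r) s m - y m) = (\<lambda>_. 0)"
  proof (rule shift_op_kernel_trivial[of r "cpoly f"])
    show "cpoly f \<noteq> 0"
      using assms(1) by (auto simp: poly_eq_iff coeff_map_poly)
    show "shift_op (cpoly f) (\<lambda>m. mat_vec (B_mat f r) s m - y m) = (\<lambda>_. 0)"
      by (simp add: fun_eq_iff shift_op_diff shift_op_rho_convolution assms)
    show "(\<lambda>m. mat_vec (B_mat f r) s m - y m) \<in> O[at_bot](geometric r)"
      "(\<lambda>m. mat_vec (B_mat f r) s m - y m) \<in> O[at_top](geometric r)"
      by (intro sum_in_bigo rho_convolution_bigo assms)+
    show "r > 0" by (fact r)
    show "cmod z \<noteq> r" if "poly (cpoly f) z = 0" for z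
      using nz that by auto
  qed
  then show ?thesis by (simp add: fun_eq_iff)
qed

end

end

section \<open>Inputs for the convolution\<close>

lemma weighted_summable:
  fixes s :: "int \<Rightarrow> complex"
  assumes "0 < l" "l < r" and zero: "\<And>n. n < M \<Longrightarrow> s n = 0" and "s \<in> O[at_top](geometric l)"
  shows "(\<lambda>n. cmod (s n) * r powi (- n)) summable_on UNIV"
proof -
  let ?g = "\<lambda>n. cmod (s n) * r powi (- n)"
  from assms(4) obtain c where "\<forall>\<^sub>F m in at_top. cmod (s m) \<le> c * cmod (geometric l m)"
    by (auto elim: landau_o.bigE)
  then obtain N where N: "\<And>m. m \<ge> N \<Longrightarrow> cmod (s m) \<le> c * l powi m"
    using assms(1) by (auto simp: eventually_at_top_linorder norm_power_int)
  have "summable (\<lambda>j. norm (?g (N + int j)))"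
  proof (rule summable_comparison_test)
    show "\<exists>J. \<forall>j\<ge>J. norm (norm (?g (N + int j))) \<le> c * (l / r) powi N * (l / r) ^ j"
    proof (intro exI[of _ 0] allI impI)
      fix j
      have "?g (N + int j) \<le> c * l powi (N + int j) * r powi (- (N + int j))"
        using assms by (intro mult_right_mono N) auto
      also have "\<dots> = c * l powi (N + int j) * inverse (r powi (N + int j))"
        by (simp only: power_int_minus)
      also have "\<dots> = c * (l / r) powi N * (l / r) ^ j"
        using assms by (simp add: power_int_add power_int_divide_distrib field_simps)
      finally show "norm (norm (?g (N + int j))) \<le> c * (l / r) powi N * (l / r) ^ j"
        using assms by simp
    qed
    show "summable (\<lambda>j. c * (l / r) powi N * (l / r) ^ j)"
      using assms by (intro summable_mult summable_geometric) auto
  qed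
  then have "(\<lambda>j. ?g (N + int j)) summable_on UNIV"
    by (rule norm_summable_imp_summable_on)
  also have "?this \<longleftrightarrow> ?g summable_on {N..}"
    by (rule summable_on_reindex_bij_witness[of _ "\<lambda>n. nat (n - N)" "\<lambda>j. N + int j"]) auto
  finally have top: "?g summable_on {N..}" .
  have "?g summable_on {M..<N} \<longleftrightarrow> ?g summable_on {..<N}"
    by (rule summable_on_cong_neutral) (auto simp: zero)
  then have "?g summable_on {..<N}" by simp
  moreover have "{..<N} \<union> {N..} = UNIV" "{..<N} \<inter> {N..} = {}" by auto
  ultimately show ?thesis
    using summable_on_Un_disjoint[of ?g "{..<N}" "{N..}"] top by simp
qed

text \<open>
  Each factor \<open>m\<close> of the polynomial is absorbed by lowering the base a little, so the induction over
  the coefficients inserts an intermediate base \<open>q\<close> between \<open>r\<close> and \<open>\<bar>a\<bar>\<close>.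
\<close>
lemma exp_poly_bigo_at_bot:
  fixes h :: "complex poly"
  assumes "0 < r" "r < cmod a"
  shows "(\<lambda>m. poly h (of_int m) * a powi m) \<in> O[at_bot](geometric r)"
  using assms
proof (induction h arbitrary: r)
  case (pCons b h)
  define q where "q = (r + cmod a) / 2"
  have q: "r < q" "0 < q" "q < cmod a" using pCons.prems by (auto simp: q_def)
  have geo: "(\<lambda>m. a powi m) \<in> O[at_bot](geometric r)"
  proof (intro bigoI[of _ 1] eventually_at_bot_linorderI[of 0])
    fix m :: int assume m: "m \<le> 0"
    have "r ^ nat (- m) \<le> cmod a ^ nat (- m)"
      using pCons.prems by (intro power_mono) auto
    then have "inverse (cmod a ^ nat (- m)) \<le> inverse (r ^ nat (- m))"
      using pCons.prems by (intro le_imp_inverse_le) auto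
    with pCons.prems m show "cmod (a powi m) \<le> 1 * cmod (geometric r m)"
      by (auto simp: norm_power_int power_int_def power_inverse norm_inverse norm_power)
  qed
  have lin: "(\<lambda>m. of_int m * geometric q m) \<in> O[at_bot](geometric r)"
  proof -
    have "(\<lambda>n. of_nat n * (r / q) ^ n) \<longlonglongrightarrow> 0"
      using q pCons.prems by (intro powser_times_n_limit_0) auto
    then have "\<forall>\<^sub>F n in sequentially. of_nat n * (r / q) ^ n < 1"
      by (rule order_tendstoD) simp
    then obtain N where N: "\<And>n. n \<ge> N \<Longrightarrow> of_nat n * (r / q) ^ n < 1"
      by (auto simp: eventually_sequentially)
    show ?thesis
    proof (intro bigoI[of _ 1] eventually_at_bot_linorderI[of "- int N"])
      fix m :: int assume m: "m \<le> - int N"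
      then have "real (nat (- m)) * (r / q) ^ nat (- m) < 1" by (intro N) auto
      then have "real (nat (- m)) * inverse (q ^ nat (- m)) \<le> inverse (r ^ nat (- m))"
        using q pCons.prems by (simp add: field_simps)
      moreover have "cmod (of_int m) = real (nat (- m))" using m by simp
      ultimately show "cmod (of_int m * geometric q m) \<le> 1 * cmod (geometric r m)"
        using q pCons.prems m by (auto simp: norm_mult norm_power_int power_int_def power_inverse norm_inverse norm_power)
    qed
  qed
  have "(\<lambda>m. poly h (of_int m) * a powi m) \<in> O[at_bot](geometric q)"
    using pCons.IH q by simp
  then have "(\<lambda>m. of_int m * (poly h (of_int m) * a powi m)) \<in> O[at_bot](\<lambda>m. of_int m * geometric q m)"
    by (intro landau_o.big.mult) auto
  from landau_o.big_trans[OF this lin]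
  have "(\<lambda>m. b * a powi m + of_int m * (poly h (of_int m) * a powi m)) \<in> O[at_bot](geometric r)"
    using geo by (intro sum_in_bigo) auto
  then show ?case by (simp add: algebra_simps)
qed simp

text \<open>
  The solution of \<open>p(S) u = t\<close> that vanishes below \<open>M\<close>, for monic \<open>p\<close>: the equation at
  \<open>m - degree p\<close> determines the value at \<open>m\<close> from the previous ones without any division.
\<close>
function recursive_solution :: "int poly \<Rightarrow> (int \<Rightarrow> int) \<Rightarrow> int \<Rightarrow> int \<Rightarrow> int" where
  "recursive_solution p t M m = (if m < M then 0 else
     t (m - int (degree p)) -
     (\<Sum>i<degree p. coeff p i * recursive_solution p t M (m - int (degree p) + int i)))"
  by auto
termination by (relation "Wellfounded.measure (\<lambda>(p, t, M, m). nat (m + 1 - M))") auto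

declare recursive_solution.simps [simp del]

lemma monic_integer_solution:
  assumes "lead_coeff p = 1" and zero: "\<And>m. m < M \<Longrightarrow> t m = 0"
  shows "\<exists>w :: int \<Rightarrow> int. (\<forall>m. shift_op p w m = t m) \<and> (\<forall>m<M. w m = 0)"
proof (intro exI conjI allI impI)
  let ?w = "recursive_solution p t M"
  show w0: "?w m = 0" if "m < M" for m
    using that by (subst recursive_solution.simps) simp
  show "shift_op p ?w m = t m" for m
  proof (cases "m + int (degree p) < M")
    case True
    then have "?w (m + int i) = 0" if "i \<le> degree p" for i
      using that by (intro w0) auto
    then show ?thesis using True by (simp add: shift_op_def zero)
  next
    case False
    then have "?w (m + int (degree p)) = t m - (\<Sum>i<degree p. coeff p i * ?w (m + int i))"
      by (subst recursive_solution.simps) simp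
    moreover have split: "{..degree p} = insert (degree p) {..<degree p}" by auto
    ultimately show ?thesis
      using assms(1) by (simp add: shift_op_def split)
  qed
qed

section \<open>The three claims\<close>

lemma cpoly_decompose:
  assumes "rsquarefree (cpoly P)" "f = P ^ (k + 1)"
  shows "cpoly f = smult (of_int (lead_coeff P) ^ (k + 1))
    (\<Prod>b | poly (cpoly P) b = 0. [:- b, 1:] ^ (k + 1))"
proof -
  have "lead_coeff (cpoly P) = of_int (lead_coeff P)"
    by (cases "P = 0") (simp_all add: coeff_map_poly degree_map_poly)
  with complex_poly_decompose_rsquarefree[OF assms(1)]
  have "cpoly P = smult (of_int (lead_coeff P)) (\<Prod>b | poly (cpoly P) b = 0. [:- b, 1:])"
    by simp
  then have "cpoly P ^ (k + 1) =
      smult (of_int (lead_coeff P)) (\<Prod>b | poly (cpoly P) b = 0. [:- b, 1:]) ^ (k + 1)"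
    by (rule arg_cong[where f = "\<lambda>p. p ^ (k + 1)"])
  then show ?thesis
    by (simp only: assms(2) cpoly_power smult_power prod_power_distrib)
qed

lemma x_seq_recurrence:
  assumes P: "coeff P 0 \<noteq> 0" and \<alpha>: "root_numbering P r1 r2 \<alpha>" and f: "f = P ^ (k + 1)"
    and g: "g \<in> Xi r1 r2 k"
  shows "shift_op (cpoly f) (\<lambda>m. complex_of_real (x_seq r1 r2 \<alpha> g m)) m = 0"
proof -
  have "shift_op (cpoly f) (\<lambda>m. poly (g i) (of_int m) * \<alpha> i powi m) m = 0"
    if i: "i \<in> {1..r1 + 2 * r2}" for i
  proof -
    have root: "poly (cpoly P) (\<alpha> i) = 0"
      using \<alpha> i unfolding root_numbering_def bij_betw_def by auto
    then have "[:- \<alpha> i, 1:] ^ (k + 1) dvd cpoly f"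
      unfolding f cpoly_power by (intro dvd_power_same) (simp add: poly_eq_0_iff_dvd)
    then obtain Q where "cpoly f = [:- \<alpha> i, 1:] ^ (k + 1) * Q"
      by (rule dvdE)
    then have Q: "cpoly f = Q * [:- \<alpha> i, 1:] ^ (k + 1)"
      by (simp only: mult.commute)
    have nonzero: "\<alpha> i \<noteq> 0"
      using root P by (auto simp: poly_0_coeff_0 coeff_map_poly)
    have high: "coeff (g i) j = 0" if "j \<ge> k + 1" for j
    proof -
      have "degree (g i) \<le> k" using g i unfolding Xi_def by auto
      with that show ?thesis by (intro coeff_eq_0) auto
    qed
    have "shift_op ([:- \<alpha> i, 1:] ^ (k + 1)) (\<lambda>m. poly (g i) (of_int m) * \<alpha> i powi m) = (\<lambda>_. 0)"
      by (rule shift_op_power_exp_poly_eq_0[OF nonzero]) (rule high)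
    then show ?thesis
      by (simp only: Q shift_op_mult shift_op_zero_seq)
  qed
  then show ?thesis
    by (simp add: of_real_x_seq[OF \<alpha> g] shift_op_sum)
qed

text \<open>
  The sum equals the average of itself and its complex conjugate, since its values are real. The
  coefficient of the average at \<open>\<alpha> i\<close> is the mean \<open>g i\<close> of \<open>h i\<close> and the conjugate of \<open>h (c i)\<close>, where \<open>c\<close> is
  the involution of the indices that exchanges conjugate roots, and this \<open>g\<close> is compatible with
  conjugation by construction.
\<close>
lemma symmetrise_exp_poly:
  assumes \<alpha>: "root_numbering P r1 r2 \<alpha>"
    and deg: "\<And>i. i \<in> {1..r1 + 2 * r2} \<Longrightarrow> degree (h i) \<le> k"
    and z: "\<And>m. complex_of_real (z m) = (\<Sum>i=1..r1 + 2 * r2. poly (h i) (of_int m) * \<alpha> i powi m)"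
  shows "\<exists>g\<in>Xi r1 r2 k. \<forall>m. x_seq r1 r2 \<alpha> g m = z m"
proof -
  define I where "I = {1..r1 + 2 * r2}"
  define c where "c i = (if i \<le> r1 then i else if i \<le> r1 + r2 then i + r2 else i - r2)" for i
  have c: "c i \<in> I" "c (c i) = i" if "i \<in> I" for i
    using that by (auto simp: c_def I_def)
  have \<alpha>_c: "\<alpha> (c i) = cnj (\<alpha> i)" if "i \<in> I" for i
  proof -
    consider "i \<in> {1..r1}" | j where "j \<in> {1..r2}" "i = r1 + j" | j where "j \<in> {1..r2}" "i = r1 + r2 + j"
    proof -
      have "i - r1 \<in> {1..r2}" "i = r1 + (i - r1)" if "r1 < i" "i \<le> r1 + r2"
        using that by auto
      moreover have "i - r1 - r2 \<in> {1..r2}" "i = r1 + r2 + (i - r1 - r2)" if "r1 + r2 < i"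
        using that \<open>i \<in> I\<close> by (auto simp: I_def)
      moreover have "i \<in> {1..r1}" if "i \<le> r1" using that \<open>i \<in> I\<close> by (auto simp: I_def)
      ultimately show thesis using that by (meson not_le)
    qed
    then show ?thesis
    proof cases
      case 1
      then have "\<alpha> i \<in> \<real>" using \<alpha> unfolding root_numbering_def by blast
      then show ?thesis using 1 by (simp add: c_def Reals_cnj_iff)
    next
      case 2
      then show ?thesis using \<alpha> unfolding root_numbering_def by (auto simp: c_def add_ac)
    next
      case 3
      then show ?thesis using \<alpha> unfolding root_numbering_def by (auto simp: c_def)
    qed
  qed
  have coeff_cnj: "coeff (map_poly cnj q) j = cnj (coeff q j)" for q j
    by (simp add: coeff_map_poly)
  have poly_cnj: "poly (map_poly cnj q) (of_int m) = cnj (poly q (of_int m))" for q m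
    by (induction q) (simp_all add: map_poly_pCons)
  define g where "g i = smult (1/2) (h i + map_poly cnj (h (c i)))" for i
  have g_Xi: "g \<in> Xi r1 r2 k"
    unfolding Xi_def
  proof (intro CollectI conjI ballI allI)
    fix i assume i: "i \<in> {1..r1 + 2 * r2}"
    then have "degree (h (c i)) \<le> k" "degree (h i) \<le> k"
      using c(1)[of i] deg by (auto simp: I_def)
    then show "degree (g i) \<le> k"
      using map_poly_degree_leq[of cnj "h (c i)"]
      unfolding g_def by (intro order.trans[OF degree_smult_le] degree_add_le) auto
  next
    fix i j assume "i \<in> {1..r1}"
    then have "cnj (coeff (g i) j) = coeff (g i) j"
      by (simp add: g_def c_def coeff_cnj add.commute)
    then show "coeff (g i) j \<in> \<real>" by (simp add: Reals_cnj_iff)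
  next
    fix i assume "i \<in> {1..r2}"
    then show "map_poly cnj (g (r1 + i)) = g (r1 + r2 + i)"
      by (intro poly_eqI) (auto simp: g_def c_def coeff_cnj add_ac)
  qed
  have "complex_of_real (x_seq r1 r2 \<alpha> g m) = complex_of_real (z m)" for m
  proof -
    have "(\<Sum>i\<in>I. poly (map_poly cnj (h (c i))) (of_int m) * \<alpha> i powi m) =
        (\<Sum>i\<in>I. cnj (poly (h i) (of_int m) * \<alpha> i powi m))"
      by (rule sum.reindex_bij_witness[of _ c c]) (use c \<alpha>_c in \<open>auto simp: poly_cnj power_int_def\<close>)
    also have "\<dots> = cnj (complex_of_real (z m))"
      unfolding z I_def by simp
    finally have flipped: "(\<Sum>i\<in>I. poly (map_poly cnj (h (c i))) (of_int m) * \<alpha> i powi m) =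
        complex_of_real (z m)"
      by simp
    have "(\<Sum>i\<in>I. poly (g i) (of_int m) * \<alpha> i powi m) =
        ((\<Sum>i\<in>I. poly (h i) (of_int m) * \<alpha> i powi m) +
         (\<Sum>i\<in>I. poly (map_poly cnj (h (c i))) (of_int m) * \<alpha> i powi m)) / 2"
      by (simp add: g_def distrib_right sum.distrib add_divide_distrib sum_divide_distrib)
    also have "\<dots> = complex_of_real (z m)"
      unfolding flipped by (simp add: z I_def)
    finally show ?thesis
      by (simp add: of_real_x_seq[OF \<alpha> g_Xi] I_def)
  qed
  with g_Xi show ?thesis by auto
qed

lemma B_mat_inverse:
  assumes r: "r > 0" and nz: "\<forall>z. cmod z = r \<longrightarrow> poly (cpoly f) z \<noteq> 0" and D: "degree f \<le> D"
  shows "is_inverse_matrix (B_mat f r) (A_mat D f)"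
proof -
  have "degree (cpoly f) \<le> D"
    using map_poly_degree_leq D by (rule order.trans)
  then have op: "(\<Sum>i\<le>D. of_int (coeff f i) * rho f r (n + int i)) = - of_bool (n = 0)" for n
    using shift_op_rho[OF r nz, of n]
    by (simp only: shift_op_bound) (simp add: coeff_map_poly)
  have AB: "((\<lambda>j. A_mat D f m j * B_mat f r j n) has_sum of_bool (m = n)) UNIV" for m n
  proof (rule has_sum_finite_neutralI[of "(\<lambda>i. m + int i) ` {..D}"])
    show "A_mat D f m j * B_mat f r j n = 0" if "j \<in> UNIV - (\<lambda>i. m + int i) ` {..D}" for j
    proof -
      have "\<not> (0 \<le> j - m \<and> j - m \<le> int D)"
      proof
        assume "0 \<le> j - m \<and> j - m \<le> int D"
        then have "j = m + int (nat (j - m))" "nat (j - m) \<in> {..D}" by auto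
        with that show False by blast
      qed
      then show ?thesis by (auto simp: A_mat_def)
    qed
    have "(\<Sum>j\<in>(\<lambda>i. m + int i) ` {..D}. A_mat D f m j * B_mat f r j n) =
        - (\<Sum>i\<le>D. of_int (coeff f i) * rho f r (m - n + int i))"
      by (subst sum.reindex) (auto simp: A_mat_def B_mat_def inj_on_def algebra_simps
          simp flip: sum_negf intro!: sum.cong)
    then show "of_bool (m = n) = (\<Sum>j\<in>(\<lambda>i. m + int i) ` {..D}. A_mat D f m j * B_mat f r j n)"
      by (simp add: op)
  qed auto
  have BA: "((\<lambda>j. B_mat f r m j * A_mat D f j n) has_sum of_bool (m = n)) UNIV" for m n
  proof (rule has_sum_finite_neutralI[of "(\<lambda>i. n - int i) ` {..D}"])
    show "B_mat f r m j * A_mat D f j n = 0" if "j \<in> UNIV - (\<lambda>i. n - int i) ` {..D}" for j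
    proof -
      have "\<not> (0 \<le> n - j \<and> n - j \<le> int D)"
      proof
        assume "0 \<le> n - j \<and> n - j \<le> int D"
        then have "j = n - int (nat (n - j))" "nat (n - j) \<in> {..D}" by auto
        with that show False by blast
      qed
      then show ?thesis by (auto simp: A_mat_def)
    qed
    have "(\<Sum>j\<in>(\<lambda>i. n - int i) ` {..D}. B_mat f r m j * A_mat D f j n) =
        - (\<Sum>i\<le>D. of_int (coeff f i) * rho f r (m - n + int i))"
      by (subst sum.reindex) (auto simp: A_mat_def B_mat_def inj_on_def algebra_simps
          simp flip: sum_negf intro!: sum.cong)
    then show "of_bool (m = n) = (\<Sum>j\<in>(\<lambda>i. n - int i) ` {..D}. B_mat f r m j * A_mat D f j n)"
      by (simp add: op)
  qed auto
  show ?thesis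
    unfolding is_inverse_matrix_def mat_mult_defined_def mat_mult_def
    by (intro conjI allI ext has_sum_imp_summable[OF AB] has_sum_imp_summable[OF BA]
        infsumI[OF AB] infsumI[OF BA])
qed

text \<open>
  The right-hand side \<open>s\<close> vanishes near \<open>-\<infinity>\<close> because there \<open>eps (x m) = x m\<close>, and it is bounded at
  \<open>+\<infinity>\<close>; so \<open>s\<close> has the required weighted summability, and the remainders are a tempered
  solution.
\<close>
lemma eps_sequence_reconstruction:
  assumes r: "r > 1" and nz: "\<forall>z. cmod z = r \<longrightarrow> poly (cpoly f) z \<noteq> 0" and f0: "f \<noteq> 0"
    and x: "\<And>m. shift_op (cpoly f) (\<lambda>m. complex_of_real (x m)) m = 0"
    and small: "(\<lambda>m. complex_of_real (x m)) \<in> O[at_bot](geometric r)"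
  defines "s \<equiv> \<lambda>m. - shift_op (cpoly f) (\<lambda>m. complex_of_real (eps (x m))) m"
  shows "mat_vec_defined (B_mat f r) s" "mat_vec (B_mat f r) s m = complex_of_real (eps (x m))"
proof -
  let ?e = "\<lambda>m. complex_of_real (eps (x m))"
  have r0: "r > 0" using r by simp
  obtain c where "\<forall>\<^sub>F m in at_bot. cmod (complex_of_real (x m)) \<le> c * cmod (geometric r m)"
    using small by (auto elim: landau_o.bigE)
  then obtain N where N: "\<And>m. m \<le> N \<Longrightarrow> \<bar>x m\<bar> \<le> c * r powi m"
    using r by (auto simp: eventually_at_bot_linorder norm_power_int)
  have "(\<lambda>n. c * inverse r ^ n) \<longlonglongrightarrow> c * 0"
    using r by (intro tendsto_intros LIMSEQ_power_zero) (auto simp: field_simps)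
  then have "\<forall>\<^sub>F n in sequentially. c * inverse r ^ n < 1/2"
    by (rule order_tendstoD) simp
  then obtain K where K: "\<And>n. n \<ge> K \<Longrightarrow> c * inverse r ^ n < 1/2"
    by (auto simp: eventually_sequentially)
  define M where "M = min N (- int K)"
  have tail: "eps (x m) = x m" if "m \<le> M" for m
  proof -
    have "c * r powi m < 1/2"
      using that K[of "nat (- m)"] by (auto simp: M_def power_int_def)
    then have "\<bar>x m\<bar> < 1/2"
      using N[of m] that by (auto simp: M_def)
    then have "x m = of_int 0 + x m \<and> x m \<in> {-1/2..<1/2}" by auto
    then show ?thesis unfolding eps_unique by simp
  qed
  have bounded: "cmod (?e m) \<le> 1" for m
    using eps_unique[of "x m" "round (x m)" "eps (x m)"] by auto
  have top: "?e \<in> O[at_top](geometric l)" if "l \<ge> 1" for l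
  proof (intro bigoI[of _ 1] eventually_at_top_linorderI[of 0])
    fix m :: int assume "m \<ge> 0"
    with that have "1 \<le> cmod (geometric l m)"
      by (simp add: norm_power power_int_def)
    with bounded show "cmod (?e m) \<le> 1 * cmod (geometric l m)"
      using order.trans by fastforce
  qed
  have bot: "?e \<in> O[at_bot](geometric r)"
  proof -
    have "\<forall>\<^sub>F m in at_bot. ?e m = complex_of_real (x m)"
      using tail by (auto simp: eventually_at_bot_linorder)
    from landau_o.big.in_cong[OF this] small show ?thesis by simp
  qed
  have "s m = 0" if "m < M - int (degree f)" for m
  proof -
    have "shift_op (cpoly f) ?e m = shift_op (cpoly f) (\<lambda>m. complex_of_real (x m)) m"
      unfolding shift_op_def using that map_poly_degree_leq[of complex_of_int f]
      by (intro sum.cong) (auto simp: tail)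
    then show ?thesis by (simp add: s_def x)
  qed
  moreover have "s \<in> O[at_top](geometric 1)"
    unfolding s_def using top[of 1] shift_op_bigo_geometric[of at_top 1 ?e] by simp
  ultimately have w: "(\<lambda>n. cmod (s n) * r powi (- n)) summable_on UNIV"
    by (intro weighted_summable[of 1]) (use r in auto)
  show "mat_vec_defined (B_mat f r) s"
    by (rule rho_convolution_defined[OF r0 nz w])
  have "mat_vec (B_mat f r) s = ?e"
    by (rule rho_convolution_unique[OF r0 nz w f0]) (use top bot r in \<open>auto simp: s_def\<close>)
  then show "mat_vec (B_mat f r) s m = ?e m" by simp
qed

text \<open>
  The integer solution \<open>u\<close> corrects the convolution \<open>y\<close> to an element \<open>z\<close> of the kernel without changing
  it modulo the integers. That \<open>y\<close> is real follows from uniqueness, as its conjugate solves the same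
  equation.
\<close>
lemma convolution_mod_Ints:
  assumes P: "admissible_poly P" "lead_coeff P = 1" and \<alpha>: "root_numbering P r1 r2 \<alpha>"
    and f: "f = P ^ (k + 1)" and r: "1 < r" and r\<alpha>: "\<forall>i\<in>{1..r1 + 2 * r2}. r < cmod (\<alpha> i)"
    and nz: "\<forall>z. cmod z = r \<longrightarrow> poly (cpoly f) z \<noteq> 0"
    and t: "t \<in> Omega0"
  shows "mat_vec_defined (B_mat f r) (\<lambda>n. of_int (t n)) \<and>
    (\<exists>\<epsilon>\<in>E_set r1 r2 \<alpha> k. \<forall>m. mat_vec (B_mat f r) (\<lambda>n. of_int (t n)) m - of_real (\<epsilon> m) \<in> \<int>)"
proof -
  have r0: "r > 0" using r by simp
  have f0: "f \<noteq> 0"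
    using P by (auto simp: f admissible_poly_def)
  have lead: "lead_coeff f = 1"
    by (simp only: f lead_coeff_power P(2) power_one)
  let ?t = "\<lambda>n. complex_of_int (t n)" and ?B = "B_mat f r"
  obtain M where M: "\<And>m. m < M \<Longrightarrow> t m = 0" using t by (auto simp: Omega0_def)
  define l where "l = (1 + r) / 2"
  have l: "1 < l" "l < r" using r by (auto simp: l_def)
  have "(\<lambda>m. real_of_int (t m)) \<in> O[at_top](\<lambda>m. l powi m)"
    using t l by (auto simp: Omega0_def)
  then obtain c where c: "\<forall>\<^sub>F m in at_top. \<bar>real_of_int (t m)\<bar> \<le> c * \<bar>l powi m\<bar>"
    by (auto elim: landau_o.bigE)
  have "?t \<in> O[at_top](geometric l)"
    by (rule bigoI[of _ c]) (use c l in \<open>simp add: norm_power_int power_int_abs\<close>)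
  then have w: "(\<lambda>n. cmod (?t n) * r powi (- n)) summable_on UNIV"
    by (intro weighted_summable[of l _ M]) (use l M in auto)
  note conv = rho_convolution_defined[OF r0 nz w] rho_convolution_bigo[OF r0 nz w]
    shift_op_rho_convolution[OF r0 nz w] rho_convolution_unique[OF r0 nz w f0]
  define y where "y = mat_vec ?B ?t"
  have cnj_bigo: "(\<lambda>m. cnj (mat_vec ?B ?t m)) \<in> O[F](geometric r)" for F
    using conv(2)[of F] by (simp add: bigo_def)
  have "y = (\<lambda>m. cnj (y m))"
    unfolding y_def
  proof (rule conv(4))
    fix m show "shift_op (cpoly f) (\<lambda>m. cnj (mat_vec ?B ?t m)) m = - ?t m"
      by (simp only: shift_op_cnj conv(3)) simp
  qed (fact cnj_bigo)+
  then have y_real: "complex_of_real (Re (y m)) = y m" for m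
    by (metis Reals_cnj_iff of_real_Re)
  obtain u where u: "\<And>m. shift_op f u m = t m" "\<And>m. m < M \<Longrightarrow> u m = 0"
    using monic_integer_solution[OF lead, of M t] M by blast
  define z where "z m = y m + of_int (u m)" for m
  have z_kernel: "shift_op (cpoly f) z = (\<lambda>_. 0)"
    by (simp add: fun_eq_iff z_def[abs_def] shift_op_add shift_op_of_int u y_def conv(3))
  have z_bot: "z \<in> O[at_bot](geometric r)"
  proof -
    have "\<forall>\<^sub>F m in at_bot. z m = y m"
      using u(2) by (auto simp: z_def eventually_at_bot_linorder intro!: exI[of _ "M - 1"])
    then show ?thesis
      using conv(2)[of at_bot] by (simp add: y_def landau_o.big.in_cong)
  qed
  define Z where "Z = {b. poly (cpoly P) b = 0}"
  define I where "I = {1..r1 + 2 * r2}"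
  define L where "L = \<alpha> ` I"
  have bij: "bij_betw \<alpha> {1..degree P} Z" and I: "I \<subseteq> {1..degree P}"
    and small: "\<And>i. i \<in> {1..degree P} - I \<Longrightarrow> cmod (\<alpha> i) \<le> 1"
    using \<alpha> unfolding root_numbering_def Z_def I_def by auto
  have Z: "finite Z" using bij bij_betw_finite by blast
  have LZ: "L \<subseteq> Z" and inj: "inj_on \<alpha> I"
    using bij I unfolding bij_betw_def L_def by (auto intro: inj_on_subset)
  have small': "cmod b \<le> 1" if "b \<in> Z - L" for b
  proof -
    have "b \<in> \<alpha> ` {1..degree P}" using that bij unfolding bij_betw_def by auto
    then obtain i where i: "i \<in> {1..degree P}" "b = \<alpha> i" by blast
    with that have "i \<notin> I" by (auto simp: L_def)
    with i small show ?thesis by blast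
  qed
  define big where "big = (\<Prod>b\<in>L. [:- b, 1:] ^ (k + 1))"
  define rest where "rest = (\<Prod>b\<in>Z - L. [:- b, 1:] ^ (k + 1))"
  have "rsquarefree (cpoly P)" using P(1) by (simp add: admissible_poly_def)
  from cpoly_decompose[OF this f] P(2) have "cpoly f = (\<Prod>b\<in>Z. [:- b, 1:] ^ (k + 1))"
    by (simp add: Z_def)
  also have "\<dots> = rest * big"
    unfolding rest_def big_def by (rule prod.subset_diff[OF LZ Z])
  finally have fact: "cpoly f = rest * big" .
  have "shift_op big z = (\<lambda>_. 0)"
  proof (rule shift_op_kernel_trivial[OF r0, of rest])
    show "shift_op rest (shift_op big z) = (\<lambda>_. 0)"
      using z_kernel by (simp only: fact shift_op_mult)
    show "rest \<noteq> 0"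
    proof -
      have "cpoly f \<noteq> 0"
        using f0 by (auto simp: poly_eq_iff coeff_map_poly)
      then show ?thesis using fact by auto
    qed
    show "shift_op big z \<in> O[at_bot](geometric r)"
      using z_bot r0 by (simp add: shift_op_bigo_geometric)
    have rest_root: "cmod b \<le> 1" if "poly rest b = 0" for b
      using that Z small' by (auto simp: rest_def poly_prod)
    show "cmod b \<noteq> r" if "poly rest b = 0" for b
      using rest_root[OF that] r by auto
    show "shift_op big z \<in> O[at_top](geometric r)" if "poly rest b = 0" "cmod b > r" for b
      using rest_root[OF that(1)] that(2) r by auto
  qed
  moreover have "finite L" "0 \<notin> L"
    using r r\<alpha> by (auto simp: L_def I_def)
  ultimately obtain h where h: "\<And>b j. b \<in> L \<Longrightarrow> j \<ge> k + 1 \<Longrightarrow> coeff (h b) j = 0"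
      "\<And>m. z m = (\<Sum>b\<in>L. poly (h b) (of_int m) * b powi m)"
    using exp_poly_of_kernel[of L "\<lambda>_. k + 1" z] unfolding big_def by blast
  have "\<exists>g\<in>Xi r1 r2 k. \<forall>m. x_seq r1 r2 \<alpha> g m = Re (z m)"
  proof (rule symmetrise_exp_poly[OF \<alpha>])
    show "degree (h (\<alpha> i)) \<le> k" if "i \<in> {1..r1 + 2 * r2}" for i
      using h(1)[of "\<alpha> i"] that by (intro degree_le) (auto simp: L_def I_def)
    fix m
    have "complex_of_real (Re (z m)) = z m"
      by (simp add: z_def y_real)
    also have "\<dots> = (\<Sum>i=1..r1 + 2 * r2. poly (h (\<alpha> i)) (of_int m) * \<alpha> i powi m)"
      unfolding h(2) L_def by (subst sum.reindex[OF inj]) (simp add: I_def)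
    finally show "complex_of_real (Re (z m)) = \<dots>" .
  qed
  then obtain g where g: "g \<in> Xi r1 r2 k" "\<And>m. x_seq r1 r2 \<alpha> g m = Re (z m)" by blast
  have "y m - of_real (eps (x_seq r1 r2 \<alpha> g m)) \<in> \<int>" for m
  proof -
    have "y m - of_real (eps (x_seq r1 r2 \<alpha> g m)) = of_int (round (Re (z m)) - u m)"
      by (simp add: eps_def g(2)) (simp add: z_def y_real)
    then show ?thesis by (simp only: Ints_of_int)
  qed
  then show ?thesis
    using conv(1) g(1) unfolding y_def E_set_def by auto
qed

theorem theorem1:
  fixes P f :: "int poly" and k D r1 r2 :: nat and \<alpha> :: "nat \<Rightarrow> complex" and r :: real
  assumes "admissible_poly P"
    and "root_numbering P r1 r2 \<alpha>"
    and "f = P ^ (k + 1)"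
    and "D = (k + 1) * degree P"
    and "1 < r" and "\<forall>i\<in>{1..r1 + 2 * r2}. r < cmod (\<alpha> i)"
  shows "is_inverse_matrix (B_mat f r) (A_mat D f) \<and>
    (\<forall>g\<in>Xi r1 r2 k. \<forall>\<epsilon> s :: int \<Rightarrow> real.
       (\<forall>m. \<epsilon> m = eps (x_seq r1 r2 \<alpha> g m)) \<longrightarrow>
       (\<forall>m. s m = - (\<Sum>j=0..D. of_int (coeff f j) * \<epsilon> (m + int j))) \<longrightarrow>
       mat_vec_defined (B_mat f r) (\<lambda>n. of_real (s n)) \<and>
       (\<forall>m. of_real (\<epsilon> m) = mat_vec (B_mat f r) (\<lambda>n. of_real (s n)) m)) \<and>
    (lead_coeff P = 1 \<longrightarrow>
      (\<forall>t\<in>Omega0.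
         mat_vec_defined (B_mat f r) (\<lambda>n. of_int (t n)) \<and>
         (\<exists>\<epsilon>\<in>E_set r1 r2 \<alpha> k. \<forall>m.
            mat_vec (B_mat f r) (\<lambda>n. of_int (t n)) m - of_real (\<epsilon> m) \<in> \<int>)))"
proof (intro conjI ballI allI impI)
  note P = assms(1) and \<alpha> = assms(2) and f = assms(3) and D = assms(4) and r = assms(5)
  have P0: "P \<noteq> 0" "coeff P 0 \<noteq> 0" using P by (auto simp: admissible_poly_def)
  have f0: "f \<noteq> 0" using P0 by (simp add: f)
  have D_deg: "degree f \<le> D"
    using degree_power_le[of P "k + 1"] by (simp add: f D mult.commute)
  have nz: "\<forall>z. cmod z = r \<longrightarrow> poly (cpoly f) z \<noteq> 0"
  proof (intro allI impI notI)
    fix z assume z: "cmod z = r" and "poly (cpoly f) z = 0"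
    then have "poly (cpoly P) z = 0" by (simp only: f cpoly_power poly_power power_eq_0_iff)
    then have "z \<in> \<alpha> ` {1..degree P}"
      using \<alpha> unfolding root_numbering_def bij_betw_def by simp
    then obtain i where "i \<in> {1..degree P}" "z = \<alpha> i" by auto
    moreover from this have "i \<in> {1..r1 + 2 * r2} \<or> i \<in> {r1 + 2 * r2 + 1..degree P}" by auto
    ultimately show False
      using \<alpha> r assms(6) z unfolding root_numbering_def by fastforce
  qed
  show "is_inverse_matrix (B_mat f r) (A_mat D f)"
    by (rule B_mat_inverse) (use r nz D_deg in auto)
  show "mat_vec_defined (B_mat f r) (\<lambda>n. of_real (s n))"
      "of_real (\<epsilon> m) = mat_vec (B_mat f r) (\<lambda>n. of_real (s n)) m"
    if g: "g \<in> Xi r1 r2 k" and \<epsilon>: "\<forall>m. \<epsilon> m = eps (x_seq r1 r2 \<alpha> g m)"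
      and s: "\<forall>m. s m = - (\<Sum>j=0..D. of_int (coeff f j) * \<epsilon> (m + int j))"
    for g and \<epsilon> s :: "int \<Rightarrow> real" and m
  proof -
    let ?x = "x_seq r1 r2 \<alpha> g"
    have "(\<lambda>m. complex_of_real (?x m)) \<in> O[at_bot](geometric r)"
      unfolding of_real_x_seq[OF \<alpha> g]
      by (intro big_sum_in_bigo exp_poly_bigo_at_bot) (use r assms(6) in auto)
    note rec = eps_sequence_reconstruction[OF r nz f0 x_seq_recurrence[OF P0(2) \<alpha> f g] this]
    have "complex_of_real (s n) =
        - shift_op (cpoly f) (\<lambda>m. complex_of_real (eps (?x m))) n" for n
      using s[rule_format, of n] \<epsilon> shift_op_bound[of "cpoly f" D "\<lambda>m. complex_of_real (eps (?x m))" n]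
        order.trans[OF map_poly_degree_leq[of complex_of_int f] D_deg]
      by (simp add: coeff_map_poly atLeast0AtMost)
    with rec \<epsilon> show "mat_vec_defined (B_mat f r) (\<lambda>n. of_real (s n))"
      "of_real (\<epsilon> m) = mat_vec (B_mat f r) (\<lambda>n. of_real (s n)) m" by simp_all
  qed
  show "mat_vec_defined (B_mat f r) (\<lambda>n. of_int (t n))"
    "\<exists>\<epsilon>\<in>E_set r1 r2 \<alpha> k. \<forall>m. mat_vec (B_mat f r) (\<lambda>n. of_int (t n)) m - of_real (\<epsilon> m) \<in> \<int>"
    if "lead_coeff P = 1" "t \<in> Omega0" for t
    using convolution_mod_Ints[OF P that(1) \<alpha> f r assms(6) nz that(2)] by blast+
qed

end
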